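(* For every integer $n\ge 2$, $\mathcal B_n=\mathcal J_{n,1}$.
   Context: Rows, columns and vector components are indexed by $0,1,\dots,n-1$. $Q_n$ is the real $n\times n$ matrix whose columns $\mathbf q^{(0)},\dots,\mathbf q^{(n-1)}$ are as follows: $\mathbf q^{(0)}=\frac1{\sqrt n}(1,\dots,1)^T$; for $1\le j\le\lfloor\frac{n-1}2\rfloor$, $\mathbf q^{(j)}$ has $k$-th entry $\sqrt{2/n}\,\cos(2\pi kj/n)$ and $\mathbf q^{(n-j)}$ has $k$-th entry $\sqrt{2/n}\,\sin(2\pi kj/n)$, $k=0,\dots,n-1$; if $n$ is even, $\mathbf q^{(n/2)}$ has $k$-th entry $(-1)^k/\sqrt n$. ($Q_n$ is orthogonal.) A vector $\mathbf x=(x_0,\dots,x_{n-1})^T\in\mathbb R^n$ is symmetric (resp. asymmetric) if $x_j=x_{(n-j)\bmod n}$ (resp. $x_j=-x_{(n-j)\bmod n}$) for all $j$. Define $\mathcal B_n=\{Q_n\,\mathrm{diag}(\boldsymbol\lambda)\,Q_n^T:\boldsymbol\lambda\in\mathbb R^n\text{ asymmetric}\}$. $\mathcal J_{n,1}$ is the set of all $A=(a_{l,j})\in\mathbb R^{n\times n}$ for which there is a symmetric $\mathbf a=(a_0,\dots,a_{n-1})^T\in\mathbb R^n$ with $\sum_{t=0}^{n-1}a_t=0$, with $\sum_{t=0}^{n-1}(-1)^ta_t=0$ when $n$ is even, and with $a_{l,j}=a_{(j+l)\bmod n}$ for all $l,j$ (a subclass of the reverse circulant matrices). *)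

theory Defs
  imports Complex_Main "Jordan_Normal_Form.Matrix"
begin

(* Only m < n is meaningful. The last branch covers the columns m = n - j with
   1 <= j <= (n-1) div 2; see the lemmas q_col_zero to q_col_half. *)
definition q_col :: "nat \<Rightarrow> nat \<Rightarrow> real vec" where
  "q_col n m = vec n (\<lambda>k.
     if m = 0 then 1 / sqrt (real n)
     else if m \<le> (n - 1) div 2 then sqrt (2 / real n) * cos (2 * pi * real k * real m / real n)
     else if 2 * m = n then (-1) ^ k / sqrt (real n)
     else sqrt (2 / real n) * sin (2 * pi * real k * real (n - m) / real n))"

definition Q_mat :: "nat \<Rightarrow> real mat" where
  "Q_mat n = mat_of_cols n (map (q_col n) [0..<n])"

definition symmetric_vec :: "real vec \<Rightarrow> bool" where
  "symmetric_vec x \<longleftrightarrow> (\<forall>j<dim_vec x. x $ j = x $ ((dim_vec x - j) mod dim_vec x))"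

definition asymmetric_vec :: "real vec \<Rightarrow> bool" where
  "asymmetric_vec x \<longleftrightarrow> (\<forall>j<dim_vec x. x $ j = - x $ ((dim_vec x - j) mod dim_vec x))"

definition B_set :: "nat \<Rightarrow> real mat set" where
  "B_set n = {Q_mat n * mat_diag n (\<lambda>i. v $ i) * transpose_mat (Q_mat n) | v.
                v \<in> carrier_vec n \<and> asymmetric_vec v}"

definition J1_set :: "nat \<Rightarrow> real mat set" where
  "J1_set n = {A \<in> carrier_mat n n.
     \<exists>a \<in> carrier_vec n. symmetric_vec a
       \<and> (\<Sum>t<n. a $ t) = 0
       \<and> (even n \<longrightarrow> (\<Sum>t<n. (-1) ^ t * a $ t) = 0)
       \<and> (\<forall>l<n. \<forall>j<n. A $$ (l, j) = a $ ((j + l) mod n))}"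

lemma q_col_zero: "q_col n 0 = vec n (\<lambda>k. 1 / sqrt (real n))"
  by (simp add: q_col_def)

lemma q_col_cos:
  assumes "1 \<le> j" "j \<le> (n - 1) div 2"
  shows "q_col n j = vec n (\<lambda>k. sqrt (2 / real n) * cos (2 * pi * real k * real j / real n))"
  using assms by (auto simp: q_col_def)

lemma q_col_sin:
  assumes "1 \<le> j" "j \<le> (n - 1) div 2"
  shows "q_col n (n - j) = vec n (\<lambda>k. sqrt (2 / real n) * sin (2 * pi * real k * real j / real n))"
proof -
  have "n - j \<noteq> 0" "\<not> n - j \<le> (n - 1) div 2" "2 * (n - j) \<noteq> n" "n - (n - j) = j"
    using assms by linarith+
  then show ?thesis unfolding q_col_def by (simp only: if_False)
qed

lemma q_col_half:
  assumes "even n" "0 < n"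
  shows "q_col n (n div 2) = vec n (\<lambda>k. (-1) ^ k / sqrt (real n))"
proof -
  have "n div 2 \<noteq> 0" "\<not> n div 2 \<le> (n - 1) div 2" "2 * (n div 2) = n"
    using assms by presburger+
  then show ?thesis unfolding q_col_def by (simp only: if_False if_True simp_thms)
qed

lemma Q_mat_carrier: "Q_mat n \<in> carrier_mat n n"
  using mat_of_cols_carrier(1)[of n "map (q_col n) [0..<n]"] by (simp add: Q_mat_def)

lemma col_Q_mat: "m < n \<Longrightarrow> col (Q_mat n) m = q_col n m"
  by (simp add: Q_mat_def q_col_def)

end

theory Submission
  imports Defs "HOL-Number_Theory.Cong"
begin

text \<open>
  For asymmetric \<open>\<lambda>\<close> the columns \<open>m\<close> and \<open>n - m\<close> of \<open>Q\<^sub>n\<close> contribute with opposite signs, and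
  \<open>cos x cos y - sin x sin y = cos (x + y)\<close>. Hence \<open>Q\<^sub>n diag(\<lambda>) Q\<^sub>n\<^sup>T\<close> is the reverse circulant
  matrix of \<open>a\<^sub>t = (2/n) \<Sum>\<^sub>m \<lambda>\<^sub>m cos (2\<pi>mt/n)\<close> with \<open>1 \<le> m < n/2\<close>. By orthogonality of the cosines,
  the vectors of this form are the symmetric ones without Fourier coefficient at the frequencies
  \<open>0\<close> and (for even \<open>n\<close>) \<open>n/2\<close>, which are the two sum conditions.
\<close>

section \<open>Cosines at multiples of \<open>2 * pi / n\<close>: periodicity and
  orthogonality\<close>

definition dcos :: "nat \<Rightarrow> int \<Rightarrow> real" where
  "dcos n k = cos (2 * pi * real_of_int k / real n)"

lemma dcos_0 [simp]: "dcos n 0 = 1"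
  by (simp add: dcos_def)

lemma dcos_minus [simp]: "dcos n (- k) = dcos n k"
  by (simp add: dcos_def)

lemma dcos_mult_dcos: "dcos n a * dcos n b = (dcos n (a + b) + dcos n (a - b)) / 2"
  by (simp add: dcos_def cos_times_cos add_divide_distrib diff_divide_distrib algebra_simps)

text \<open>Periodicity of the cosine. With integer arguments, sums, differences and negatives of
  indices can be reduced modulo \<open>n\<close> without truncated subtraction.\<close>

lemma dcos_cong:
  assumes "[a = b] (mod int n)"
  shows "dcos n a = dcos n b"
\<comment> \<open>For \<open>n = 0\<close> division by zero yields 0, so both sides are
  \<open>cos 0\<close>.\<close>
proof (cases "n = 0")
  case False
  obtain c where c: "b = a + int n * c"
    using assms by (auto simp: cong_iff_lin)
  have "2 * pi * real_of_int b / real n = 2 * pi * real_of_int a / real n + 2 * pi * real_of_int c"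
    using False by (simp add: c field_simps)
  then show ?thesis
    by (simp add: dcos_def cos_add)
qed (simp add: dcos_def)

lemma dcos_half:
  assumes "even n" "0 < n"
  shows "dcos n (int (n div 2) * int t) = (-1) ^ t"
proof -
  have "2 * pi * real_of_int (int (n div 2) * int t) / real n = real t * pi"
    using assms by (auto simp: field_simps elim!: evenE)
  then show ?thesis
    by (simp only: dcos_def cos_npi)
qed

text \<open>The sum is the real part of a geometric sum over powers of the \<open>n\<close>-th root
  of unity \<open>z\<close>, and \<open>z = 1\<close> only if \<open>n\<close> divides
  \<open>d\<close>.\<close>

lemma sum_dcos:
  assumes "0 < n"
  shows "(\<Sum>k<n. dcos n (d * int k)) = (if int n dvd d then real n else 0)"
proof (cases "int n dvd d")
  case True
  have "dcos n (d * int k) = 1" for k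
    using True dcos_cong[of "d * int k" 0 n] by (simp add: cong_0_iff)
  then show ?thesis
    using True by simp
next
  case False
  define z where "z = cis (2 * pi * real_of_int d / real n)"
  have pow: "z ^ k = cis (2 * pi * real_of_int (d * int k) / real n)" for k
    by (simp add: z_def DeMoivre mult_ac)
  have "2 * pi * real_of_int (d * int n) / real n = 2 * pi * real_of_int d"
    using assms by simp
  then have "z ^ n = 1"
    by (simp only: pow) (rule cis_multiple_2pi, simp)
  moreover have "z \<noteq> 1"
  proof
    assume "z = 1"
    then have "cos (2 * pi * real_of_int d / real n) = 1"
      by (metis z_def cis.sel(1) one_complex.sel(1))
    then obtain x :: int where "2 * pi * real_of_int d / real n = real_of_int x * 2 * pi"
      by (auto simp: cos_one_2pi_int)
    then have "real_of_int d = real_of_int (x * int n)"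
      using assms by (simp add: field_simps)
    then show False
      using False by (simp only: of_int_eq_iff) simp
  qed
  ultimately have "(\<Sum>k<n. z ^ k) = 0"
    by (simp add: geometric_sum)
  then have "Re (\<Sum>k<n. z ^ k) = 0"
    by simp
  then show ?thesis
    using False by (simp add: pow dcos_def)
qed

text \<open>Product-to-sum formula, then \<open>sum_dcos\<close>. The two divisibility conditions
  can hold together, so they stay separate summands.\<close>

lemma dcos_orthogonal:
  assumes "0 < n"
  shows "(\<Sum>k<n. dcos n (a * int k) * dcos n (b * int k)) =
    ((if int n dvd a + b then real n else 0) + (if int n dvd a - b then real n else 0)) / 2"
proof -
  have "(\<Sum>k<n. dcos n (a * int k) * dcos n (b * int k)) =
      (\<Sum>k<n. dcos n ((a + b) * int k) + dcos n ((a - b) * int k)) / 2"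
    by (simp add: dcos_mult_dcos sum_divide_distrib algebra_simps)
  then show ?thesis
    by (simp add: sum.distrib sum_dcos[OF assms])
qed

section \<open>The index reflection taking \<open>m\<close> to \<open>n - m\<close>\<close>

lemma sum_fold_reflect:
  fixes f :: "nat \<Rightarrow> 'a::comm_monoid_add"
  assumes "0 < n"
  shows "(\<Sum>m<n. f m) =
    f 0 + (if even n then f (n div 2) else 0) + (\<Sum>m=1..(n - 1) div 2. f m + f (n - m))"
proof -
  let ?h = "(n - 1) div 2"
  let ?H = "if even n then {n div 2} else {}"
  \<comment> \<open>Modulo \<open>n\<close> the reflection fixes only 0 and, for even
    \<open>n\<close>, \<open>n div 2\<close>; it pairs the indices \<open>1..?h\<close> with the
    last \<open>?h\<close> indices.\<close>
  have split: "{..<n} = (insert 0 ?H \<union> {1..?h}) \<union> {n - ?h..<n}"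
    using assms by (auto split: if_splits; presburger)
  have disj1: "(insert 0 ?H \<union> {1..?h}) \<inter> {n - ?h..<n} = {}"
    using assms by (auto split: if_splits; presburger)
  have disj2: "insert 0 ?H \<inter> {1..?h} = {}"
    using assms by (auto split: if_splits; presburger)
  have refl: "sum f {n - ?h..<n} = (\<Sum>m=1..?h. f (n - m))"
    by (rule sum.reindex_bij_witness[of _ "\<lambda>m. n - m" "\<lambda>m. n - m"]) auto
  have "(\<Sum>m<n. f m) = sum f (insert 0 ?H \<union> {1..?h}) + sum f {n - ?h..<n}"
    unfolding split by (rule sum.union_disjoint[OF _ _ disj1]) auto
  also have "sum f (insert 0 ?H \<union> {1..?h}) = sum f (insert 0 ?H) + sum f {1..?h}"
    by (rule sum.union_disjoint[OF _ _ disj2]) auto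
  also have "sum f (insert 0 ?H) = f 0 + (if even n then f (n div 2) else 0)"
    using assms by (auto elim!: evenE)
  finally show ?thesis
    by (simp only: refl sum.distrib add.assoc)
qed

text \<open>At the fixed points 0 and \<open>n div 2\<close> of the reflection an entry equals its
  own negative.\<close>

lemma asymmetric_vec_reflect:
  assumes "asymmetric_vec v" "v \<in> carrier_vec n"
  shows "0 < n \<Longrightarrow> v $ 0 = 0" "even n \<Longrightarrow> 0 < n \<Longrightarrow> v $ (n div 2) = 0"
    "0 < m \<Longrightarrow> m < n \<Longrightarrow> v $ (n - m) = - v $ m"
proof -
  have v: "v $ j = - v $ ((n - j) mod n)" if "j < n" for j
    using assms that unfolding asymmetric_vec_def by (metis carrier_vecD)
  show "0 < n \<Longrightarrow> v $ 0 = 0"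
    using v[of 0] by simp
  show "even n \<Longrightarrow> 0 < n \<Longrightarrow> v $ (n div 2) = 0"
    using v[of "n div 2"] by (auto elim!: evenE)
  show "0 < m \<Longrightarrow> m < n \<Longrightarrow> v $ (n - m) = - v $ m"
    using v[of m] by simp
qed

section \<open>Entries of the matrices in \<open>B_set\<close>\<close>

lemma Q_mat_diag_entry:
  assumes "l < n" "j < n"
  shows "(Q_mat n * mat_diag n d * transpose_mat (Q_mat n)) $$ (l, j) =
    (\<Sum>m<n. d m * (q_col n m $ l * q_col n m $ j))"
proof -
  have Q: "Q_mat n $$ (i, m) = q_col n m $ i" if "i < n" "m < n" for i m
    using that by (simp add: Q_mat_def mat_of_cols_index)
  show ?thesis
    using assms Q_mat_carrier[of n]
    by (auto simp: mat_diag_mult_right[OF Q_mat_carrier] scalar_prod_def Q atLeast0LessThan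
        intro!: sum.cong)
qed

text \<open>The addition theorem leaves only \<open>l + j\<close>, hence a reverse circulant
  pattern; the sum of the two products would depend on \<open>l - j\<close> instead.\<close>

lemma q_col_mult_diff:
  assumes "1 \<le> m" "m \<le> (n - 1) div 2" "l < n" "j < n"
  shows "q_col n m $ l * q_col n m $ j - q_col n (n - m) $ l * q_col n (n - m) $ j =
    2 / real n * dcos n (int m * int (l + j))"
proof -
  have *: "2 * pi * (real m * (real l + real j)) / real n =
      2 * pi * real l * real m / real n + 2 * pi * real j * real m / real n"
    by (simp add: add_divide_distrib algebra_simps)
  have s: "sqrt (2 / real n) * x * (sqrt (2 / real n) * y) = 2 / real n * (x * y)" for x y
  proof -
    have "sqrt (2 / real n) * x * (sqrt (2 / real n) * y) =
        sqrt (2 / real n) * sqrt (2 / real n) * (x * y)"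
      by (simp only: mult_ac)
    also have "sqrt (2 / real n) * sqrt (2 / real n) = 2 / real n"
      by (rule real_sqrt_mult_self[THEN trans]) simp
    finally show ?thesis .
  qed
  show ?thesis
    using assms
    by (simp add: q_col_cos q_col_sin s dcos_def * cos_add right_diff_distrib del: real_sqrt_divide)
qed

text \<open>After folding, asymmetry kills the terms at 0 and \<open>n div 2\<close> and turns each
  remaining pair into the difference treated in \<open>q_col_mult_diff\<close>.\<close>

lemma Q_mat_asymmetric_diag_entry:
  assumes v: "asymmetric_vec v" "v \<in> carrier_vec n" and lj: "l < n" "j < n"
  shows "(Q_mat n * mat_diag n (\<lambda>i. v $ i) * transpose_mat (Q_mat n)) $$ (l, j) =
    2 / real n * (\<Sum>m=1..(n - 1) div 2. v $ m * dcos n (int m * int (l + j)))"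
proof -
  have n: "0 < n"
    using lj by simp
  let ?f = "\<lambda>m. v $ m * (q_col n m $ l * q_col n m $ j)"
  have "?f m + ?f (n - m) = 2 / real n * (v $ m * dcos n (int m * int (l + j)))"
    if "m \<in> {1..(n - 1) div 2}" for m
  proof -
    have m: "0 < m" "m < n"
      using that by auto
    have "?f m + ?f (n - m) =
        v $ m * (q_col n m $ l * q_col n m $ j - q_col n (n - m) $ l * q_col n (n - m) $ j)"
      by (simp add: asymmetric_vec_reflect(3)[OF v m] algebra_simps)
    then show ?thesis
      using q_col_mult_diff[of m n l j] that lj by simp
  qed
  then have "(\<Sum>m=1..(n - 1) div 2. ?f m + ?f (n - m)) =
      2 / real n * (\<Sum>m=1..(n - 1) div 2. v $ m * dcos n (int m * int (l + j)))"
    unfolding sum_distrib_left by (intro sum.cong) auto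
  then show ?thesis
    using asymmetric_vec_reflect(1,2)[OF v] n
    by (simp add: Q_mat_diag_entry[OF lj] sum_fold_reflect[OF n])
qed

section \<open>Symmetry, orthogonality and inversion of cosine sums\<close>

lemma dcos_mult_mod: "dcos n (int m * int (t mod n)) = dcos n (int m * int t)"
  by (rule dcos_cong) (simp add: cong_def zmod_int mod_mult_right_eq)

text \<open>The cosine is even and periodic. The first form serves to reflect a vector position, the
  second a frequency.\<close>

lemma dcos_reflect:
  assumes "t \<le> n"
  shows "dcos n (int m * int ((n - t) mod n)) = dcos n (int m * int t)"
    "dcos n (int (n - t) * int m) = dcos n (int t * int m)"
proof -
  have "[int m * int (n - t) = - (int m * int t)] (mod int n)"
    using assms by (simp add: of_nat_diff right_diff_distrib cong_iff_dvd_diff)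
  then have *: "dcos n (int m * int (n - t)) = dcos n (int m * int t)"
    by (metis dcos_cong dcos_minus)
  then show "dcos n (int m * int ((n - t) mod n)) = dcos n (int m * int t)"
    by (simp only: dcos_mult_mod)
  from * show "dcos n (int (n - t) * int m) = dcos n (int t * int m)"
    by (simp only: mult.commute)
qed

text \<open>For \<open>0 < m < n / 2\<close> and \<open>k\<close> equal to 0 or
  \<open>n / 2\<close>, neither \<open>k + m\<close> nor \<open>k - m\<close> is a multiple of
  \<open>n\<close>, so \<open>dcos_orthogonal\<close> gives 0.\<close>

lemma cosine_sum_orthogonal:
  assumes n: "0 < n" and k: "2 * k = n \<or> k = 0"
  shows "(\<Sum>t<n. dcos n (int k * int t) * (\<Sum>m=1..(n - 1) div 2. c m * dcos n (int m * int t))) = 0"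
proof -
  have "(\<Sum>t<n. dcos n (int k * int t) * dcos n (int m * int t)) = 0"
    if "m \<in> {1..(n - 1) div 2}" for m
  proof -
    have m: "0 < m" "2 * m < n"
      using that by auto
    then have ndvd: "\<not> n dvd m"
      by (intro nat_dvd_not_less) auto
    have "\<not> int n dvd int k + int m"
      using m k ndvd by (auto simp: zdvd_not_zless)
    moreover have "\<not> int n dvd int k - int m"
    proof (cases "k = 0")
      case False
      then show ?thesis
        using m k by (auto simp: zdvd_not_zless)
    qed (use ndvd in simp)
    ultimately show ?thesis
      by (simp add: dcos_orthogonal[OF n])
  qed
  moreover have "(\<Sum>t<n. dcos n (int k * int t) * (\<Sum>m=1..(n - 1) div 2. c m * dcos n (int m * int t)))
      = (\<Sum>m=1..(n - 1) div 2. c m * (\<Sum>t<n. dcos n (int k * int t) * dcos n (int m * int t)))"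
    unfolding sum_distrib_left by (subst sum.swap) (simp add: mult_ac)
  ultimately show ?thesis
    by simp
qed

text \<open>After exchanging the sums, orthogonality selects \<open>s = t\<close> and the reflection
  of \<open>t\<close>, each with weight \<open>n / 2\<close>; symmetry of \<open>a\<close> makes the
  two contributions equal.\<close>

lemma cosine_inversion:
  assumes a: "a \<in> carrier_vec n" "symmetric_vec a" and t: "t < n"
  shows "(\<Sum>m<n. (\<Sum>s<n. a $ s * dcos n (int m * int s)) * dcos n (int m * int t)) = real n * a $ t"
proof -
  have n: "0 < n"
    using t by simp
  let ?r = "(n - t) mod n"
  have dvd1: "int n dvd int s + int t \<longleftrightarrow> s = ?r" if "s < n" for s
  proof -
    have "int n dvd int s + int t \<longleftrightarrow> n dvd s + t"
      by (metis of_nat_add of_nat_dvd_iff)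
    also have "\<dots> \<longleftrightarrow> s = ?r"
    proof
      assume "n dvd s + t"
      then obtain q where q: "s + t = n * q" ..
      \<comment> \<open>Both indices are below \<open>n\<close>, so the quotient is 0, forcing
        \<open>s = t = 0\<close>, or 1, giving \<open>s = n - t\<close>.\<close>
      then have "n * q < n * 2"
        using that t by linarith
      then have "q = 0 \<or> q = 1"
        by auto
      then show "s = ?r"
        using q that t by (cases "t = 0") auto
    next
      show "s = ?r \<Longrightarrow> n dvd s + t"
        using t by (cases "t = 0") auto
    qed
    finally show ?thesis .
  qed
  have dvd2: "int n dvd int s - int t \<longleftrightarrow> s = t" if "s < n" for s
    using that t 
    by (metis cong_iff_dvd_diff cong_int_iff cong_less_modulus_unique_nat cong_refl)
  have "(\<Sum>m<n. (\<Sum>s<n. a $ s * dcos n (int m * int s)) * dcos n (int m * int t)) =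
      (\<Sum>s<n. a $ s * (\<Sum>m<n. dcos n (int s * int m) * dcos n (int t * int m)))"
    unfolding sum_distrib_left sum_distrib_right by (subst sum.swap) (simp add: mult_ac)
  \<comment> \<open>The summands stay separate because \<open>t\<close> may be its own reflection;
    then both select the same \<open>s\<close>.\<close>
  also have "\<dots> = (\<Sum>s<n. (if s = ?r then real n / 2 * a $ s else 0)
      + (if s = t then real n / 2 * a $ s else 0))"
    by (rule sum.cong) (auto simp: dcos_orthogonal[OF n] dvd1 dvd2)
  also have "\<dots> = real n / 2 * a $ ?r + real n / 2 * a $ t"
    using t by (simp add: sum.distrib)
  also have "a $ ?r = a $ t"
    using a t unfolding symmetric_vec_def by (metis carrier_vecD)
  finally show ?thesis
    by simp
qed

section \<open>Equality of the two matrix classes by two inclusions\<close>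

theorem theorem3p8:
  fixes n :: nat
  assumes "n \<ge> 2"
  shows "B_set n = J1_set n"
proof -
  have n: "0 < n"
    using assms by simp
  let ?h = "(n - 1) div 2"
  have "A \<in> J1_set n" if "A \<in> B_set n" for A
  proof -
    from that obtain v where v: "asymmetric_vec v" "v \<in> carrier_vec n"
      and A: "A = Q_mat n * mat_diag n (\<lambda>i. v $ i) * transpose_mat (Q_mat n)"
      by (auto simp: B_set_def)
    define g where "g t = (\<Sum>m=1..?h. v $ m * dcos n (int m * int t))" for t
    define a where "a = vec n (\<lambda>t. 2 / real n * g t)"
    \<comment> \<open>Taking \<open>k = 0\<close> gives the plain sum condition and
      \<open>k = n div 2\<close> the alternating one.\<close>
    have ortho: "(\<Sum>t<n. dcos n (int k * int t) * a $ t) = 0" if "2 * k = n \<or> k = 0" for k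
    proof -
      have "(\<Sum>t<n. dcos n (int k * int t) * a $ t) =
          2 / real n * (\<Sum>t<n. dcos n (int k * int t) * g t)"
        unfolding sum_distrib_left by (rule sum.cong) (auto simp: a_def)
      then show ?thesis
        using cosine_sum_orthogonal[OF n that, of "\<lambda>m. v $ m"] by (simp add: g_def)
    qed
    have "A \<in> carrier_mat n n"
      using Q_mat_carrier[of n] by (intro carrier_matI) (auto simp: A)
    moreover have "a \<in> carrier_vec n"
      by (simp add: a_def)
    moreover have "symmetric_vec a"
      using n by (simp add: symmetric_vec_def a_def g_def dcos_reflect)
    moreover have "(\<Sum>t<n. a $ t) = 0"
      using ortho[of 0] by simp
    moreover have "even n \<longrightarrow> (\<Sum>t<n. (-1) ^ t * a $ t) = 0"
    proof
      assume "even n"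
      then show "(\<Sum>t<n. (-1) ^ t * a $ t) = 0"
        using ortho[of "n div 2"] by (simp add: dcos_half n)
    qed
    moreover have "\<forall>l<n. \<forall>j<n. A $$ (l, j) = a $ ((j + l) mod n)"
    proof (intro allI impI)
      fix l j assume "l < n" "j < n"
      then have "A $$ (l, j) = 2 / real n * g (l + j)"
        by (simp only: A Q_mat_asymmetric_diag_entry[OF v] g_def)
      also have "g (l + j) = g ((j + l) mod n)"
        by (simp only: g_def dcos_mult_mod add.commute)
      finally show "A $$ (l, j) = a $ ((j + l) mod n)"
        using n by (simp add: a_def)
    qed
    ultimately show ?thesis
      by (auto simp: J1_set_def)
  qed
  moreover have "A \<in> B_set n" if "A \<in> J1_set n" for A
  proof -
    from that obtain a where A: "A \<in> carrier_mat n n" and a: "a \<in> carrier_vec n" "symmetric_vec a"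
      and sum: "(\<Sum>t<n. a $ t) = 0" "even n \<Longrightarrow> (\<Sum>t<n. (-1) ^ t * a $ t) = 0"
      and entry: "\<And>l j. l < n \<Longrightarrow> j < n \<Longrightarrow> A $$ (l, j) = a $ ((j + l) mod n)"
      by (auto simp: J1_set_def)
    define b where "b m = (\<Sum>s<n. a $ s * dcos n (int m * int s))" for m
    \<comment> \<open>The coefficients \<open>b\<close> are invariant under reflection, so the upper
      half changes sign to make \<open>v\<close> asymmetric. The value 0 in the middle loses
      nothing, by \<open>b_half\<close>.\<close>
    define v where "v = vec n (\<lambda>m. if 2 * m < n then b m else if 2 * m = n then 0 else - b m)"
    have b0: "b 0 = 0"
      using sum(1) by (simp add: b_def)
    have b_half: "b (n div 2) = 0" if "even n"
      using sum(2)[OF that] by (simp add: b_def dcos_half[OF that n] mult.commute[of "a $ _"])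
    have b_reflect: "b (n - m) = b m" if "0 < m" "m < n" for m
      using that by (simp only: b_def dcos_reflect(2) less_imp_le)
    have v: "asymmetric_vec v" "v \<in> carrier_vec n"
    proof -
      have "v $ m = - v $ ((n - m) mod n)" if "m < n" for m
      \<comment> \<open>Index 0 is its own reflection, so asymmetry there needs
        \<open>b 0 = 0\<close>, the first sum condition.\<close>
      proof (cases "m = 0")
        case False
        then have "(n - m) mod n = n - m" "n - m < n" "b (n - m) = b m"
          using that b_reflect[of m] by auto
        moreover have "2 * (n - m) < n \<longleftrightarrow> n < 2 * m" "2 * (n - m) = n \<longleftrightarrow> 2 * m = n"
          using that by linarith+
        ultimately show ?thesis
          using that by (simp add: v_def)
      qed (use n b0 in \<open>simp add: v_def\<close>)
      moreover have "dim_vec v = n"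
        by (simp add: v_def)
      ultimately show "asymmetric_vec v"
        unfolding asymmetric_vec_def by metis
    qed (simp add: v_def)
    have a_eq: "a $ t = 2 / real n * (\<Sum>m=1..?h. v $ m * dcos n (int m * int t))" if "t < n" for t
    proof -
      have "real n * a $ t = (\<Sum>m<n. b m * dcos n (int m * int t))"
        unfolding b_def by (rule cosine_inversion[OF a that, symmetric])
      \<comment> \<open>The sum conditions remove the frequencies 0 and \<open>n / 2\<close>; the
        two terms of each remaining pair agree, whence the factor 2 in
        \<open>2 / real n\<close>.\<close>
      also have "\<dots> = (\<Sum>m=1..?h. b m * dcos n (int m * int t) + b (n - m) * dcos n (int (n - m) * int t))"
        using b0 b_half by (simp add: sum_fold_reflect[OF n])
      also have "\<dots> = (\<Sum>m=1..?h. 2 * (v $ m * dcos n (int m * int t)))"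
      proof (rule sum.cong)
        fix m assume "m \<in> {1..?h}"
        then have "0 < m" "m < n" "2 * m < n"
          by auto
        then show "b m * dcos n (int m * int t) + b (n - m) * dcos n (int (n - m) * int t) =
            2 * (v $ m * dcos n (int m * int t))"
          by (simp add: b_reflect dcos_reflect(2) v_def del: of_nat_diff)
      qed simp
      finally show ?thesis
        using n by (simp only: sum_distrib_left[symmetric]) (simp add: field_simps)
    qed
    have "A = Q_mat n * mat_diag n (\<lambda>i. v $ i) * transpose_mat (Q_mat n)" (is "_ = ?B")
    proof (rule eq_matI)
      fix l j assume "l < dim_row ?B" "j < dim_col ?B"
      then have lj: "l < n" "j < n"
        using Q_mat_carrier[of n] by auto
      have "A $$ (l, j) = a $ ((l + j) mod n)"
        by (simp only: entry[OF lj] add.commute)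
      also have "\<dots> = ?B $$ (l, j)"
        by (simp only: a_eq[OF mod_less_divisor[OF n]] Q_mat_asymmetric_diag_entry[OF v lj]
            dcos_mult_mod)
      finally show "A $$ (l, j) = ?B $$ (l, j)" .
    qed (use A Q_mat_carrier[of n] in auto)
    then show ?thesis
      using v by (auto simp: B_set_def)
  qed
  ultimately show ?thesis
    by blast
qed

end
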